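(* Let $\boldsymbol{\varphi}$ be the random roughness profile and $\boldsymbol{\alpha}\colon\Gamma_0\to\mathbb{R}$ the associated (random) slip amount on the smooth wall $\Gamma_0$. Suppose $\boldsymbol{\alpha}$ is uniformly bounded and Lipschitz, uniformly over realizations: there are known constants $C_\alpha,\gamma_1,\gamma_3>0$ with $\boldsymbol{\alpha}(x)\le\gamma_1C_\alpha$ and $|\boldsymbol{\alpha}(x)-\boldsymbol{\alpha}(y)|\le\frac{\gamma_1}{\gamma_3}C_\alpha|x-y|$ for all $x,y\in\Gamma_0$, where $\lim_{\epsilon\to0}\epsilon/\gamma_1=\lim_{\epsilon\to0}\gamma_1/\gamma_3=0$. Let $\gamma_2>0$ satisfy $\lim_{\epsilon\to0}\gamma_1/\gamma_2=\lim_{\epsilon\to0}\gamma_2/(\gamma_1\gamma_3)=0$, and set $\eta_1=\gamma_1/\gamma_2$, $\eta_2=1/\gamma_2$. Assume that, uniformly for all $x\in\Gamma_0$ and all $\epsilon>0$, the random micro domain $\mathbf{Y}_x$ with boundary data $h$, Riesz representors $\mathbf{r}_1,\mathbf{r}_2$ and approximations $\mathbf{s}_{1,x}=\mathcal{O}[\tilde{\mathbf{r}}_1,\partial\mathbf{Y}_x]$, $\mathbf{s}_{2,x}=\mathcal{O}[\tilde{\mathbf{r}}_2,\partial\mathbf{Y}_x]$, all with values in $C(\partial\mathbf{Y}_x,\mathbb{R}^2)$, satisfies: $\mathbf{r}_1$ and $h$ are almost surely uniformly $\eta_1$-aligned; $\mathbf{s}_{2,x}$ and $h$ are almost surely uniformly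 $\eta_2$-aligned; the slip amount $\langle\mathbf{r}_1,h\rangle_{\partial\mathbf{Y}_x}/\langle\mathbf{r}_2,h\rangle_{\partial\mathbf{Y}_x}$ is almost surely bounded in absolute value by $\gamma_1C_\alpha$; and, for some $\delta>0$, $$\mathbb{E}\left[\frac{\|\mathbf{s}_{1,x}-\mathbf{r}_1\|^2_{\partial\mathbf{Y}_x}}{\|\mathbf{r}_1\|^2_{\partial\mathbf{Y}_x}}\right]\le\delta^2,\qquad\mathbb{E}\left[\frac{\|\mathbf{s}_{2,x}-\mathbf{r}_2\|^2_{\partial\mathbf{Y}_x}}{\|\mathbf{s}_{2,x}\|^2_{\partial\mathbf{Y}_x}}\right]\le\delta^2.$$ Let $\{x_n\}_{n=1}^N\subset\Gamma_0$ discretize $\Gamma_0$ with resolution $|\Gamma_0|/N$, i.e. $\max_{z\in\Gamma_0}\min_n\|z-x_n\|\le|\Gamma_0|/N$ where $|\Gamma_0|$ is the length of $\Gamma_0$, and define $$\tilde{\boldsymbol{\alpha}}_n:=-\frac{\langle\mathbf{s}_{1,x_n},h\rangle_{\partial\mathbf{Y}_{x_n}}}{\langle\mathbf{s}_{2,x_n},h\rangle_{\partial\mathbf{Y}_{x_n}}},\qquad n=1,\dots,N.$$ Then for any interpolant $\tilde{\boldsymbol{\alpha}}(z)=\mathcal{I}[(\tilde{\boldsymbol{\alpha}}_n)_{n=1}^N](z)$ such that $\mathcal{I}$ tightly interpolates $\boldsymbol{\alpha}$ to the first order, there is a suitable choice of $N$ such that $$\mathbb{E}\left[\sup_{z\in\Gamma_0}|\tilde{\boldsymbol{\alpha}}(z)-\boldsymbol{\alpha}(z)|\right]\le2\gamma_1C\sqrt{\delta\,|\Gamma_0|\,\gamma_2/(\gamma_1\gamma_3)},$$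 where $C>0$ depends only on $C_\alpha$ and on the interpolation constant $C_{\mathcal{I}}$.
   Context: Bold symbols denote random variables. The number of sample points $N$ is a free parameter: for each $N$ one has sample points and an interpolant as described, with constants not depending on $N$. Geometry: $\epsilon>0$ is the roughness scale; $\gamma_1,\gamma_2,\gamma_3$ may depend on $\epsilon$. $\Gamma_0$ is the smooth wall, a part of the boundary of the smooth macroscopic domain $\Omega_0\subset\mathbb{R}^2$, with unit normal $n$. The rough wall is $\Gamma_\epsilon=\{x+\epsilon\boldsymbol{\varphi}(x_t/\epsilon)n(x)\mid x\in\Gamma_0\}$, where $\boldsymbol{\varphi}$ is a random $C^2$ function and $x_t$ denotes the tangential parameter of $x$ along $\Gamma_0$. Micro problems and slip amount: for $x\in\Gamma_0$ one constructs a micro domain $Y_x$ (with boundary a simple closed $C^2$ curve) such that $\partial Y_x\cap\Gamma_\epsilon=\mathcal{B}_\epsilon(x)\cap\Gamma_\epsilon$, where $\mathcal{B}_\epsilon(x)$ is an $\epsilon$-sized ball around $x$. The micro boundary data $h$ on $\partial Y_x$ is continuous, has zero net flow through $\partial Y_x$, equals the macroscopic velocity on $\Omega_0\cap\partial Y_x$ and equals $0$ on $\Gamma_\epsilon\cap\partial Y_x$. Let $\chi$ solve $-\Delta\chi+\nabla\pi=0$, $\nabla\cdot\chi=0$ in $Y_x$, $\chi=h$ on $\partial Y_x$, and let $L\subset\Omega_0\cap Y_x$ be a straight line segment with unit tangent $t$ and unit normal $n$. The Riesz representors $r_1,r_2\in C(\partial Y_x,\mathbb{R}^2)$ depend only on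 $Y_x$ and $L$ and satisfy $\langle r_1,h\rangle_{\partial Y_x}=\langle\chi,t\rangle_L$ and $\langle r_2,h\rangle_{\partial Y_x}=\langle\partial_n\chi,t\rangle_L$ for all continuous data $h$ with zero net flow ($L^2$-inner products). The slip amount at $x$ is $\boldsymbol{\alpha}(x)=-\langle\chi,t\rangle_L/\langle\partial_n\chi,t\rangle_L=-\langle h,r_1\rangle_{\partial Y_x}/\langle h,r_2\rangle_{\partial Y_x}$. The operator $\mathcal{O}$ is an arbitrary (learned) map producing, from the domain and intermediate quantities $\tilde{\mathbf{r}}_1,\tilde{\mathbf{r}}_2$ determined by $Y_x$ and $L$, approximations of the representors. Alignment: two elements $v,w$ of a Hilbert space are $\eta$-aligned, $0<\eta<1$, if $\langle v,w\rangle/(\|v\|\|w\|)\ge\eta$. Random elements are almost surely uniformly $\eta$-aligned if the probability that they are not $\eta$-aligned is $0$. Here the Hilbert space is $L^2(\partial\mathbf{Y}_x,\mathbb{R}^2)$ with inner product $\langle\cdot,\cdot\rangle_{\partial\mathbf{Y}_x}$ and norm $\|\cdot\|_{\partial\mathbf{Y}_x}$. Interpolant: for points $\{x_n\}_{n=1}^N\subset K$, an interpolant is a continuous linear operator $\mathcal{I}\colon\mathbb{R}^N\to C(K,\mathbb{R})$ with $\mathcal{I}[(\alpha_j)_{j=1}^N](x_n)=\alpha_n$ for all $n$ and with $\sup_{z\in K}|\mathcal{I}[(\alpha_j)_{j=1}^N](z)|\le C_{\mathcal{I}}\max_n|\alpha_n|$ for all $(\alpha_j)_{j=1}^N\in\mathbb{R}^N$.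 It tightly interpolates a Lipschitz function $\alpha\colon K\to\mathbb{R}$ with Lipschitz constant $L>0$ to the first order if $|\mathcal{I}[(\alpha(x_j))_{j=1}^N](z)-\alpha(z)|\le C_{\mathcal{I}}L\max_{w\in K}\min_n\|w-x_n\|$ for all $z\in K$, with $C_{\mathcal{I}}>0$ independent of $L$. Here $K=\Gamma_0$.
   Formalization: The claim fails for large δ (s1=r1, s2=r2/(1+δ) gives error δ|α| at sample points for every N), so it is proved for each ε at which δ is small enough: δ ≤ 1/γ2 and √(γ1|Γ0|/(γ2γ3δ)) ≥ max(1, γ1²). *)

theory Defs
  imports "HOL-Probability.Probability"
begin

type_synonym plane = "real ^ 2"

text \<open>Meant for open sets \<open>U\<close> only: the derivative is taken \<open>at x\<close>, not \<open>at x within U\<close>.\<close>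

primrec C_k :: "nat \<Rightarrow> 'a::euclidean_space set \<Rightarrow> ('a \<Rightarrow> 'b::euclidean_space) \<Rightarrow> bool" where
  "C_k 0 U f \<longleftrightarrow> continuous_on U f"
| "C_k (Suc k) U f \<longleftrightarrow>
     (\<exists>f'. (\<forall>x\<in>U. (f has_derivative f' x) (at x)) \<and> (\<forall>b\<in>Basis. C_k k U (\<lambda>x. f' x b)))"

definition smooth_on :: "'a::euclidean_space set \<Rightarrow> ('a \<Rightarrow> 'b::euclidean_space) \<Rightarrow> bool" where
  "smooth_on U f \<longleftrightarrow> (\<forall>k. C_k k U f)"

definition perp :: "plane \<Rightarrow> plane" where
  "perp v = vector [v $ 2, - (v $ 1)]"

text \<open>A domain whose boundary is locally a regular level set of a smooth function, with the
  domain on one side.\<close>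

definition smooth_domain :: "plane set \<Rightarrow> bool" where
  "smooth_domain \<Omega> \<longleftrightarrow> open \<Omega> \<and> connected \<Omega> \<and> \<Omega> \<noteq> {} \<and>
     (\<forall>p\<in>frontier \<Omega>. \<exists>U (\<psi> :: plane \<Rightarrow> real). open U \<and> p \<in> U \<and> smooth_on U \<psi> \<and>
        (\<forall>y\<in>U. \<exists>v. frechet_derivative \<psi> (at y) v \<noteq> 0) \<and> \<Omega> \<inter> U = {y \<in> U. \<psi> y < 0})"

text \<open>The wall is given by an arc length parametrization \<open>g\<close> on \<open>[0, l]\<close>; hence \<open>l\<close> is its
  length, and \<open>t\<close> is the tangential parameter of the point \<open>g t\<close>. It may be an arc or a closed
  curve. A smooth arc or closed curve extends (in the latter case periodically) to a smooth map
  on the whole line, so that the derivatives at the end points need no separate treatment.\<close>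

definition smooth_wall :: "plane set \<Rightarrow> (real \<Rightarrow> plane) \<Rightarrow> real \<Rightarrow> (plane \<Rightarrow> plane) \<Rightarrow> bool" where
  "smooth_wall \<Omega> g l n \<longleftrightarrow> 0 < l \<and> smooth_on UNIV g \<and> simple_path (\<lambda>s. g (s * l)) \<and>
     (\<forall>t\<in>{0..l}. norm (vector_derivative g (at t)) = 1) \<and>
     g ` {0..l} \<subseteq> frontier \<Omega> \<and> continuous_on (g ` {0..l}) n \<and>
     (\<forall>t\<in>{0..l}. norm (n (g t)) = 1 \<and> n (g t) \<bullet> vector_derivative g (at t) = 0)"

definition rough_wall ::
    "(real \<Rightarrow> plane) \<Rightarrow> real \<Rightarrow> (plane \<Rightarrow> plane) \<Rightarrow> real \<Rightarrow> (real \<Rightarrow> real) \<Rightarrow> plane set" where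
  "rough_wall g l n \<epsilon> \<phi> = (\<lambda>t. g t + (\<epsilon> * \<phi> (t / \<epsilon>)) *\<^sub>R n (g t)) ` {0..l}"

text \<open>A micro domain is described by a regular parametrization \<open>c\<close> on \<open>[0, 1]\<close> of its boundary,
  extended periodically; the domain itself is then \<open>inside (path_image c)\<close>.\<close>

definition C2_jordan_curve :: "(real \<Rightarrow> plane) \<Rightarrow> bool" where
  "C2_jordan_curve c \<longleftrightarrow> simple_path c \<and> (\<forall>t. c (t + 1) = c t) \<and> C_k 2 UNIV c \<and>
     (\<forall>t. vector_derivative c (at t) \<noteq> 0)"

text \<open>The inner product and norm of \<open>L\<^sup>2\<close> of the boundary with respect to arc length. They do
  not depend on the choice of the parametrization.\<close>

definition bdry_inner :: "(real \<Rightarrow> plane) \<Rightarrow> (plane \<Rightarrow> plane) \<Rightarrow> (plane \<Rightarrow> plane) \<Rightarrow> real" where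
  "bdry_inner c v w =
     integral {0..1} (\<lambda>t. (v (c t) \<bullet> w (c t)) * norm (vector_derivative c (at t)))"

definition bdry_norm :: "(real \<Rightarrow> plane) \<Rightarrow> (plane \<Rightarrow> plane) \<Rightarrow> real" where
  "bdry_norm c v = sqrt (bdry_inner c v v)"

text \<open>The flow through the boundary, up to the sign given by the orientation of \<open>c\<close>: the unit
  normal times the arc length element is \<open>perp (c' t) dt\<close>.\<close>

definition net_flow :: "(real \<Rightarrow> plane) \<Rightarrow> (plane \<Rightarrow> plane) \<Rightarrow> real" where
  "net_flow c h = integral {0..1} (\<lambda>t. h (c t) \<bullet> perp (vector_derivative c (at t)))"

definition aligned :: "real \<Rightarrow> (real \<Rightarrow> plane) \<Rightarrow> (plane \<Rightarrow> plane) \<Rightarrow> (plane \<Rightarrow> plane) \<Rightarrow> bool" where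
  "aligned \<eta> c v w \<longleftrightarrow> 0 < \<eta> \<and> \<eta> < 1 \<and> bdry_inner c v w / (bdry_norm c v * bdry_norm c w) \<ge> \<eta>"

definition rel_error_sq ::
    "(real \<Rightarrow> plane) \<Rightarrow> (plane \<Rightarrow> plane) \<Rightarrow> (plane \<Rightarrow> plane) \<Rightarrow> (plane \<Rightarrow> plane) \<Rightarrow> real" where
  "rel_error_sq c s r w = (bdry_norm c (\<lambda>y. s y - r y))\<^sup>2 / (bdry_norm c w)\<^sup>2"

definition laplacian :: "(plane \<Rightarrow> plane) \<Rightarrow> plane \<Rightarrow> plane" where
  "laplacian u y =
     (\<Sum>b\<in>Basis. frechet_derivative (\<lambda>z. frechet_derivative u (at z) b) (at y) b)"

definition gradient :: "(plane \<Rightarrow> real) \<Rightarrow> plane \<Rightarrow> plane" where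
  "gradient q y = (\<Sum>b\<in>Basis. frechet_derivative q (at y) b *\<^sub>R b)"

definition divergence :: "(plane \<Rightarrow> plane) \<Rightarrow> plane \<Rightarrow> real" where
  "divergence u y = (\<Sum>b\<in>Basis. frechet_derivative u (at y) b \<bullet> b)"

definition stokes_solution ::
    "plane set \<Rightarrow> (plane \<Rightarrow> plane) \<Rightarrow> (plane \<Rightarrow> plane) \<Rightarrow> (plane \<Rightarrow> real) \<Rightarrow> bool" where
  "stokes_solution Y h u q \<longleftrightarrow>
     C_k 2 Y u \<and> C_k 1 Y q \<and> continuous_on (closure Y) u \<and>
     (\<forall>y\<in>Y. - laplacian u y + gradient q y = 0) \<and>
     (\<forall>y\<in>Y. divergence u y = 0) \<and>
     (\<forall>y\<in>frontier Y. u y = h y)"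

text \<open>A line segment together with a choice of one of its two unit normals.\<close>

record segm =
  seg_a :: plane
  seg_b :: plane
  seg_n :: plane

definition seg_t :: "segm \<Rightarrow> plane" where
  "seg_t S = (1 / norm (seg_b S - seg_a S)) *\<^sub>R (seg_b S - seg_a S)"

definition valid_segm :: "segm \<Rightarrow> bool" where
  "valid_segm S \<longleftrightarrow> seg_a S \<noteq> seg_b S \<and> norm (seg_n S) = 1 \<and> seg_n S \<bullet> seg_t S = 0"

definition seg_integral :: "segm \<Rightarrow> (plane \<Rightarrow> real) \<Rightarrow> real" where
  "seg_integral S f =
     norm (seg_b S - seg_a S) * integral {0..1} (\<lambda>s. f (linepath (seg_a S) (seg_b S) s))"

definition seg_velocity :: "segm \<Rightarrow> (plane \<Rightarrow> plane) \<Rightarrow> real" where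
  "seg_velocity S u = seg_integral S (\<lambda>y. u y \<bullet> seg_t S)"

definition seg_shear :: "segm \<Rightarrow> (plane \<Rightarrow> plane) \<Rightarrow> real" where
  "seg_shear S u = seg_integral S (\<lambda>y. frechet_derivative u (at y) (seg_n S) \<bullet> seg_t S)"

text \<open>\<open>r\<close> is a continuous Riesz representor, as a function of the boundary data, of the functional
  \<open>\<Lambda>\<close> of the Stokes velocity in the domain bounded by \<open>c\<close>.\<close>

definition representor ::
    "(real \<Rightarrow> plane) \<Rightarrow> ((plane \<Rightarrow> plane) \<Rightarrow> real) \<Rightarrow> (plane \<Rightarrow> plane) \<Rightarrow> bool" where
  "representor c \<Lambda> r \<longleftrightarrow> continuous_on (path_image c) r \<and>
     (\<forall>h u q. continuous_on (path_image c) h \<and> net_flow c h = 0 \<and>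
        stokes_solution (inside (path_image c)) h u q \<longrightarrow> bdry_inner c r h = \<Lambda> u)"

text \<open>The arguments of the micro quantities are the roughness
  scale, the realization and the point of the smooth wall. The macroscopic velocity is an
  arbitrary field. An \<open>\<epsilon>\<close>-sized ball is one of radius \<open>ball_size * \<epsilon>\<close>. The representors and
  the intermediate quantities from which the learned operator starts are functions of the
  micro domain and the line segment only; the intermediate quantities have an arbitrary type.\<close>

record ('w, 'q) rough_problem =
  prob :: "'w measure"
  macro_dom :: "plane set"
  wall_curve :: "real \<Rightarrow> plane"
  wall_length :: real
  wall_normal :: "plane \<Rightarrow> plane"
  profile :: "'w \<Rightarrow> real \<Rightarrow> real"
  macro_vel :: "real \<Rightarrow> 'w \<Rightarrow> plane \<Rightarrow> plane"
  ball_size :: real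
  micro_curve :: "real \<Rightarrow> 'w \<Rightarrow> plane \<Rightarrow> real \<Rightarrow> plane"
  micro_seg :: "real \<Rightarrow> 'w \<Rightarrow> plane \<Rightarrow> segm"
  micro_data :: "real \<Rightarrow> 'w \<Rightarrow> plane \<Rightarrow> plane \<Rightarrow> plane"
  micro_vel :: "real \<Rightarrow> 'w \<Rightarrow> plane \<Rightarrow> plane \<Rightarrow> plane"
  micro_pres :: "real \<Rightarrow> 'w \<Rightarrow> plane \<Rightarrow> plane \<Rightarrow> real"
  rep1 :: "plane set \<Rightarrow> segm \<Rightarrow> plane \<Rightarrow> plane"
  rep2 :: "plane set \<Rightarrow> segm \<Rightarrow> plane \<Rightarrow> plane"
  inter1 :: "plane set \<Rightarrow> segm \<Rightarrow> 'q"
  inter2 :: "plane set \<Rightarrow> segm \<Rightarrow> 'q"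
  learned :: "'q \<Rightarrow> plane set \<Rightarrow> plane \<Rightarrow> plane"

definition wall :: "('w, 'q) rough_problem \<Rightarrow> plane set" where
  "wall P = wall_curve P ` {0..wall_length P}"

definition rough :: "('w, 'q) rough_problem \<Rightarrow> real \<Rightarrow> 'w \<Rightarrow> plane set" where
  "rough P \<epsilon> \<omega> = rough_wall (wall_curve P) (wall_length P) (wall_normal P) \<epsilon> (profile P \<omega>)"

definition micro_dom :: "('w, 'q) rough_problem \<Rightarrow> real \<Rightarrow> 'w \<Rightarrow> plane \<Rightarrow> plane set" where
  "micro_dom P \<epsilon> \<omega> x = inside (path_image (micro_curve P \<epsilon> \<omega> x))"

definition micro_bdry :: "('w, 'q) rough_problem \<Rightarrow> real \<Rightarrow> 'w \<Rightarrow> plane \<Rightarrow> plane set" where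
  "micro_bdry P \<epsilon> \<omega> x = path_image (micro_curve P \<epsilon> \<omega> x)"

definition r1 :: "('w, 'q) rough_problem \<Rightarrow> real \<Rightarrow> 'w \<Rightarrow> plane \<Rightarrow> plane \<Rightarrow> plane" where
  "r1 P \<epsilon> \<omega> x = rep1 P (micro_dom P \<epsilon> \<omega> x) (micro_seg P \<epsilon> \<omega> x)"

definition r2 :: "('w, 'q) rough_problem \<Rightarrow> real \<Rightarrow> 'w \<Rightarrow> plane \<Rightarrow> plane \<Rightarrow> plane" where
  "r2 P \<epsilon> \<omega> x = rep2 P (micro_dom P \<epsilon> \<omega> x) (micro_seg P \<epsilon> \<omega> x)"

definition s1 :: "('w, 'q) rough_problem \<Rightarrow> real \<Rightarrow> 'w \<Rightarrow> plane \<Rightarrow> plane \<Rightarrow> plane" where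
  "s1 P \<epsilon> \<omega> x =
     learned P (inter1 P (micro_dom P \<epsilon> \<omega> x) (micro_seg P \<epsilon> \<omega> x)) (micro_bdry P \<epsilon> \<omega> x)"

definition s2 :: "('w, 'q) rough_problem \<Rightarrow> real \<Rightarrow> 'w \<Rightarrow> plane \<Rightarrow> plane \<Rightarrow> plane" where
  "s2 P \<epsilon> \<omega> x =
     learned P (inter2 P (micro_dom P \<epsilon> \<omega> x) (micro_seg P \<epsilon> \<omega> x)) (micro_bdry P \<epsilon> \<omega> x)"

definition slip :: "('w, 'q) rough_problem \<Rightarrow> real \<Rightarrow> 'w \<Rightarrow> plane \<Rightarrow> real" where
  "slip P \<epsilon> \<omega> x =
     - (seg_velocity (micro_seg P \<epsilon> \<omega> x) (micro_vel P \<epsilon> \<omega> x)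
        / seg_shear (micro_seg P \<epsilon> \<omega> x) (micro_vel P \<epsilon> \<omega> x))"

definition approx_slip :: "('w, 'q) rough_problem \<Rightarrow> real \<Rightarrow> 'w \<Rightarrow> plane \<Rightarrow> real" where
  "approx_slip P \<epsilon> \<omega> x =
     - (bdry_inner (micro_curve P \<epsilon> \<omega> x) (s1 P \<epsilon> \<omega> x) (micro_data P \<epsilon> \<omega> x)
        / bdry_inner (micro_curve P \<epsilon> \<omega> x) (s2 P \<epsilon> \<omega> x) (micro_data P \<epsilon> \<omega> x))"

text \<open>The condition on \<open>seg_shear\<close> says that the quotient defining the slip amount exists.\<close>

definition micro_problem :: "('w, 'q) rough_problem \<Rightarrow> real \<Rightarrow> 'w \<Rightarrow> plane \<Rightarrow> bool" where
  "micro_problem P \<epsilon> \<omega> x \<longleftrightarrow>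
     C2_jordan_curve (micro_curve P \<epsilon> \<omega> x) \<and>
     micro_bdry P \<epsilon> \<omega> x \<inter> rough P \<epsilon> \<omega> = cball x (ball_size P * \<epsilon>) \<inter> rough P \<epsilon> \<omega> \<and>
     valid_segm (micro_seg P \<epsilon> \<omega> x) \<and>
     closed_segment (seg_a (micro_seg P \<epsilon> \<omega> x)) (seg_b (micro_seg P \<epsilon> \<omega> x))
       \<subseteq> macro_dom P \<inter> micro_dom P \<epsilon> \<omega> x \<and>
     continuous_on (micro_bdry P \<epsilon> \<omega> x) (micro_data P \<epsilon> \<omega> x) \<and>
     net_flow (micro_curve P \<epsilon> \<omega> x) (micro_data P \<epsilon> \<omega> x) = 0 \<and>
     (\<forall>y \<in> macro_dom P \<inter> micro_bdry P \<epsilon> \<omega> x. micro_data P \<epsilon> \<omega> x y = macro_vel P \<epsilon> \<omega> y) \<and>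
     (\<forall>y \<in> rough P \<epsilon> \<omega> \<inter> micro_bdry P \<epsilon> \<omega> x. micro_data P \<epsilon> \<omega> x y = 0) \<and>
     stokes_solution (micro_dom P \<epsilon> \<omega> x) (micro_data P \<epsilon> \<omega> x)
       (micro_vel P \<epsilon> \<omega> x) (micro_pres P \<epsilon> \<omega> x) \<and>
     seg_shear (micro_seg P \<epsilon> \<omega> x) (micro_vel P \<epsilon> \<omega> x) \<noteq> 0 \<and>
     representor (micro_curve P \<epsilon> \<omega> x) (seg_velocity (micro_seg P \<epsilon> \<omega> x)) (r1 P \<epsilon> \<omega> x) \<and>
     representor (micro_curve P \<epsilon> \<omega> x) (seg_shear (micro_seg P \<epsilon> \<omega> x)) (r2 P \<epsilon> \<omega> x) \<and>
     continuous_on (micro_bdry P \<epsilon> \<omega> x) (s1 P \<epsilon> \<omega> x) \<and>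
     continuous_on (micro_bdry P \<epsilon> \<omega> x) (s2 P \<epsilon> \<omega> x)"

text \<open>The fields live on the random sets \<open>micro_bdry P \<epsilon> \<omega> x\<close>. That they are random
  elements enters through the measurability of the inner products below.\<close>

definition rough_problem :: "('w, 'q) rough_problem \<Rightarrow> bool" where
  "rough_problem P \<longleftrightarrow>
     prob_space (prob P) \<and>
     smooth_domain (macro_dom P) \<and>
     smooth_wall (macro_dom P) (wall_curve P) (wall_length P) (wall_normal P) \<and>
     (\<forall>\<omega>\<in>space (prob P). C_k 2 UNIV (profile P \<omega>)) \<and>
     (\<forall>t. (\<lambda>\<omega>. profile P \<omega> t) \<in> borel_measurable (prob P)) \<and>
     0 < ball_size P \<and>
     (\<forall>\<epsilon>>0. \<forall>x\<in>wall P. \<forall>\<omega>\<in>space (prob P). micro_problem P \<epsilon> \<omega> x) \<and>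
     (\<forall>\<epsilon>>0. \<forall>x\<in>wall P. \<forall>f\<in>{r1 P, r2 P, s1 P, s2 P}.
        (\<lambda>\<omega>. bdry_inner (micro_curve P \<epsilon> \<omega> x) (f \<epsilon> \<omega> x) (micro_data P \<epsilon> \<omega> x))
          \<in> borel_measurable (prob P))"

text \<open>An element of \<open>\<real>\<^sup>N\<close> is a sequence of which only the entries with index in
  \<open>{1..N}\<close> matter. The last bound makes the linear operator continuous and makes it depend on
  these entries only.\<close>

definition interpolant ::
    "plane set \<Rightarrow> nat \<Rightarrow> (nat \<Rightarrow> plane) \<Rightarrow> real \<Rightarrow> ((nat \<Rightarrow> real) \<Rightarrow> plane \<Rightarrow> real) \<Rightarrow> bool" where
  "interpolant K N x CI I \<longleftrightarrow>
     (\<forall>a. continuous_on K (I a)) \<and>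
     (\<forall>a b. \<forall>z\<in>K. I (\<lambda>n. a n + b n) z = I a z + I b z) \<and>
     (\<forall>s a. \<forall>z\<in>K. I (\<lambda>n. s * a n) z = s * I a z) \<and>
     (\<forall>a. \<forall>n\<in>{1..N}. I a (x n) = a n) \<and>
     (\<forall>a. \<forall>z\<in>K. \<bar>I a z\<bar> \<le> CI * Max ((\<lambda>n. \<bar>a n\<bar>) ` {1..N}))"

definition resolution :: "plane set \<Rightarrow> nat \<Rightarrow> (nat \<Rightarrow> plane) \<Rightarrow> real" where
  "resolution K N x = (SUP w\<in>K. Min ((\<lambda>n. norm (w - x n)) ` {1..N}))"

definition tightly_interpolates ::
    "plane set \<Rightarrow> nat \<Rightarrow> (nat \<Rightarrow> plane) \<Rightarrow> real \<Rightarrow> ((nat \<Rightarrow> real) \<Rightarrow> plane \<Rightarrow> real)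
      \<Rightarrow> real \<Rightarrow> (plane \<Rightarrow> real) \<Rightarrow> bool" where
  "tightly_interpolates K N x CI I L f \<longleftrightarrow> 0 < L \<and> L-lipschitz_on K f \<and>
     (\<forall>z\<in>K. \<bar>I (\<lambda>j. f (x j)) z - f z\<bar> \<le> CI * L * resolution K N x)"

text \<open>The error bound is obtained by balancing the interpolation error against the error at the
  sample points, with a number of sample points close to \<open>sqrt (g1 * l / (g2 * g3 * d))\<close>. This
  is possible only if the accuracy \<open>d\<close> of the learned operator is good enough: this number has
  to be at least \<open>1\<close> and at least \<open>g1\<^sup>2\<close>, and \<open>d\<close> must not exceed the alignment \<open>1 / g2\<close>.\<close>

definition accurate :: "real \<Rightarrow> real \<Rightarrow> real \<Rightarrow> real \<Rightarrow> real \<Rightarrow> bool" where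
  "accurate g1 g2 g3 l d \<longleftrightarrow>
     d \<le> 1 / g2 \<and> 1 \<le> sqrt (g1 * l / (g2 * g3 * d)) \<and> g1\<^sup>2 \<le> sqrt (g1 * l / (g2 * g3 * d))"

end

theory Submission
  imports Defs
begin

text \<open>Write the slip amount as \<open>- a / b\<close> with \<open>a = \<langle>r1, h\<rangle>\<close>, \<open>b = \<langle>r2, h\<rangle>\<close> and its
  approximation as \<open>- s / t\<close> with \<open>s = \<langle>s1, h\<rangle>\<close>, \<open>t = \<langle>s2, h\<rangle>\<close>. Then
  \<open>s / t - a / b = (s - a) / t + (a / b) * ((b - t) / t)\<close>. By Cauchy-Schwarz the numerators
  are bounded by \<open>L\<^sup>2\<close> errors of the representors times the norm of \<open>h\<close>, and alignment bounds
  the products of norms by \<open>\<bar>a\<bar> / \<eta>1\<close> and \<open>t / \<eta>2\<close>. So the error at one point of the wall is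
  controlled by the two relative errors \<open>e1\<close>, \<open>e2\<close> of the representors: up to the constant bounding
  the slip amount it is at most \<open>\<gamma>2 * (e1 * (1 + \<gamma>2 * e2) + \<gamma>1 * e2)\<close> (\<open>slip_error\<close>).

  Interpolation adds an error proportional to \<open>\<gamma>1 / \<gamma>3 * l / N\<close>, where \<open>l\<close> is the length of the
  wall, and turns the errors at the \<open>N\<close> sample points into a multiple of their maximum
  (\<open>interpolation_error\<close>). The expected maximum of the terms in \<open>e1\<close> is estimated by the
  sum over the sample points, hence, as \<open>\<gamma>2 * \<delta> \<le> 1\<close>, by a multiple of \<open>\<gamma>2 * N * \<delta>\<close>. The remaining term carries the
  factor \<open>\<gamma>1\<close>, for which no upper bound is known except \<open>\<gamma>1\<^sup>2 \<le> N\<close>; the cruder sum would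
  lose this factor. Since \<open>E[e2\<^sup>2] \<le> \<delta>\<^sup>2\<close>, the maximum of \<open>e2\<close> may be estimated by the
  Euclidean norm over the sample points instead, which gives \<open>\<gamma>1 * \<gamma>2 * sqrt N * \<delta> \<le> \<gamma>2 * N * \<delta>\<close>.
  Balancing \<open>\<gamma>1 / \<gamma>3 * l / N\<close> against \<open>\<gamma>2 * N * \<delta>\<close> leads to
  \<open>N \<approx> sqrt (\<gamma>1 * l / (\<gamma>2 * \<gamma>3 * \<delta>))\<close>, for which both are of the size of the asserted bound
  (\<open>balanced_error\<close>). The supremum over the wall is a random variable because by continuity it
  equals the supremum over a countable dense subset.\<close>

section \<open>The inner product on the boundary of a micro domain\<close>

lemma C_k_imp_continuous_on:
  assumes "C_k k U f"
  shows "continuous_on U f"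
proof (cases k)
  case (Suc j)
  with assms obtain f' where "\<forall>x\<in>U. (f has_derivative f' x) (at x)"
    by auto
  then show ?thesis
    by (meson continuous_at_imp_continuous_on has_derivative_continuous)
qed (use assms in auto)

lemma C2_jordan_curve_continuous:
  assumes "C2_jordan_curve c"
  shows "continuous_on UNIV c" "continuous_on UNIV (\<lambda>t. vector_derivative c (at t))"
proof -
  have C2: "C_k (Suc (Suc 0)) UNIV c"
    using assms by (simp add: C2_jordan_curve_def numeral_2_eq_2)
  then show "continuous_on UNIV c"
    by (rule C_k_imp_continuous_on)
  from C2 obtain c' where c': "\<And>t. (c has_derivative c' t) (at t)"
    and "\<forall>b\<in>Basis. C_k (Suc 0) UNIV (\<lambda>t. c' t b)"
    by (metis C_k.simps(2) UNIV_I)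
  then have "C_k (Suc 0) UNIV (\<lambda>t. c' t 1)"
    by simp
  then have cont: "continuous_on UNIV (\<lambda>t. c' t 1)"
    by (rule C_k_imp_continuous_on)
  have "vector_derivative c (at t) = c' t 1" for t
  proof (rule vector_derivative_at)
    have "linear (c' t)"
      using c' has_derivative_linear by blast
    then have "c' t = (\<lambda>s. s *\<^sub>R c' t 1)"
      by (metis linear_scale mult.right_neutral real_scaleR_def)
    then show "(c has_vector_derivative c' t 1) (at t)"
      unfolding has_vector_derivative_def using c' by metis
  qed
  with cont show "continuous_on UNIV (\<lambda>t. vector_derivative c (at t))"
    by simp
qed

lemma bdry_inner_integrable:
  fixes v w :: "plane \<Rightarrow> plane"
  assumes "C2_jordan_curve c" "continuous_on (path_image c) v" "continuous_on (path_image c) w"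
  shows "(\<lambda>t. (v (c t) \<bullet> w (c t)) * norm (vector_derivative c (at t))) integrable_on {0..1}"
proof -
  have c: "continuous_on {0..1} c" "continuous_on {0..1} (\<lambda>t. vector_derivative c (at t))"
    using C2_jordan_curve_continuous[OF assms(1)] continuous_on_subset by blast+
  have comp: "continuous_on {0..1} (\<lambda>t. u (c t))" if "continuous_on (path_image c) u"
    for u :: "plane \<Rightarrow> plane"
    using continuous_on_compose2[OF that c(1)] by (simp add: path_image_def)
  show ?thesis
    by (intro integrable_continuous_real continuous_on_mult continuous_on_inner
      continuous_on_norm comp[OF assms(2)] comp[OF assms(3)] c)
qed

lemma bdry_inner_commute: "bdry_inner c v w = bdry_inner c w v"
  by (simp add: bdry_inner_def inner_commute)

lemma bdry_inner_diff_left: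
  assumes "C2_jordan_curve c" "continuous_on (path_image c) u"
    "continuous_on (path_image c) v" "continuous_on (path_image c) w"
  shows "bdry_inner c (\<lambda>y. u y - v y) w = bdry_inner c u w - bdry_inner c v w"
  unfolding bdry_inner_def
  using integral_diff[OF bdry_inner_integrable[OF assms(1,2,4)] bdry_inner_integrable[OF assms(1,3,4)]]
  by (simp add: inner_diff_left left_diff_distrib)

lemma bdry_inner_scale_left: "bdry_inner c (\<lambda>y. k *\<^sub>R v y) w = k * bdry_inner c v w"
  unfolding bdry_inner_def by (subst integral_mult_right[symmetric]) (simp add: mult.assoc)

lemma bdry_inner_nonneg: "0 \<le> bdry_inner c v v"
  unfolding bdry_inner_def by (cases "(\<lambda>t. (v (c t) \<bullet> v (c t)) * norm (vector_derivative c (at t))) integrable_on {0..1}")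
    (auto intro: integral_nonneg simp: not_integrable_integral)

lemma bdry_norm_nonneg: "0 \<le> bdry_norm c v"
  by (simp add: bdry_norm_def bdry_inner_nonneg)

text \<open>Different fields may agree on the curve, so the form is only semidefinite. It is applied to
  \<open>v\<close> minus its projection on \<open>w\<close>, which exists because \<open>w\<close> does not vanish.\<close>

lemma bdry_Cauchy_Schwarz:
  assumes c: "C2_jordan_curve c" and v: "continuous_on (path_image c) v"
    and w: "continuous_on (path_image c) w" and "bdry_norm c w \<noteq> 0"
  shows "\<bar>bdry_inner c v w\<bar> \<le> bdry_norm c v * bdry_norm c w"
proof -
  define k where "k = bdry_inner c v w / bdry_inner c w w"
  have pos: "0 < bdry_inner c w w"
    using assms(4) bdry_inner_nonneg[of c w] by (auto simp: bdry_norm_def)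
  have kw: "continuous_on (path_image c) (\<lambda>y. k *\<^sub>R w y)"
    and d: "continuous_on (path_image c) (\<lambda>y. v y - k *\<^sub>R w y)"
    using v w by (auto intro!: continuous_intros)
  have left: "bdry_inner c (\<lambda>y. v y - k *\<^sub>R w y) u = bdry_inner c v u - k * bdry_inner c w u"
    if "continuous_on (path_image c) u" for u
    using bdry_inner_diff_left[OF c v kw that] by (simp add: bdry_inner_scale_left)
  have "0 \<le> bdry_inner c (\<lambda>y. v y - k *\<^sub>R w y) (\<lambda>y. v y - k *\<^sub>R w y)"
    by (rule bdry_inner_nonneg)
  also have "\<dots> = (bdry_inner c v v - k * bdry_inner c w v)
      - k * (bdry_inner c v w - k * bdry_inner c w w)"
    unfolding left[OF d] bdry_inner_commute[of c v "\<lambda>y. v y - k *\<^sub>R w y"]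
      bdry_inner_commute[of c w "\<lambda>y. v y - k *\<^sub>R w y"] left[OF v] left[OF w] ..
  also have "\<dots> = bdry_inner c v v - (bdry_inner c v w)\<^sup>2 / bdry_inner c w w"
    using pos by (simp add: k_def bdry_inner_commute[of c w v] power2_eq_square)
  finally have "(bdry_inner c v w)\<^sup>2 \<le> bdry_inner c v v * bdry_inner c w w"
    using pos by (simp add: field_simps)
  then show ?thesis
    unfolding bdry_norm_def by (metis real_sqrt_le_mono real_sqrt_abs real_sqrt_mult)
qed

text \<open>Alignment entails that neither field vanishes on the curve: a division by \<open>0\<close> yields \<open>0\<close>,
  which is below \<open>\<eta>\<close>.\<close>

lemma aligned_imp:
  assumes "aligned \<eta> c v w"
  shows "0 < \<eta>" "0 < bdry_norm c v" "0 < bdry_norm c w"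
    "\<eta> * (bdry_norm c v * bdry_norm c w) \<le> bdry_inner c v w"
proof -
  show \<eta>: "0 < \<eta>"
    using assms by (simp add: aligned_def)
  then have "bdry_norm c v * bdry_norm c w \<noteq> 0"
    using assms by (auto simp: aligned_def)
  then show pos: "0 < bdry_norm c v" "0 < bdry_norm c w"
    using bdry_norm_nonneg[of c v] bdry_norm_nonneg[of c w] by (auto simp: less_le)
  show "\<eta> * (bdry_norm c v * bdry_norm c w) \<le> bdry_inner c v w"
    using assms pos by (simp add: aligned_def pos_le_divide_eq)
qed

lemma rel_error_sq_nonneg: "0 \<le> rel_error_sq c s r w"
  by (simp add: rel_error_sq_def)

lemma bdry_inner_error:
  assumes "C2_jordan_curve c" "continuous_on (path_image c) s" "continuous_on (path_image c) r"
    "continuous_on (path_image c) h" "bdry_norm c h \<noteq> 0" "0 < bdry_norm c w"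
  shows "\<bar>bdry_inner c s h - bdry_inner c r h\<bar>
    \<le> sqrt (rel_error_sq c s r w) * (bdry_norm c w * bdry_norm c h)"
proof -
  have "\<bar>bdry_inner c s h - bdry_inner c r h\<bar> = \<bar>bdry_inner c (\<lambda>y. s y - r y) h\<bar>"
    using bdry_inner_diff_left assms by simp
  also have "\<dots> \<le> bdry_norm c (\<lambda>y. s y - r y) * bdry_norm c h"
    using assms by (intro bdry_Cauchy_Schwarz continuous_intros) auto
  also have "\<dots> = sqrt (rel_error_sq c s r w) * (bdry_norm c w * bdry_norm c h)"
    using assms by (simp add: rel_error_sq_def real_sqrt_divide bdry_norm_nonneg)
  finally show ?thesis .
qed

section \<open>The error of the slip amount at a point of the wall\<close>

text \<open>Here \<open>x\<close> and \<open>y\<close> are relative errors of the numerator and of the denominator. The first is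
  relative to the exact and the second to the approximate value, so dividing the numerator error
  by \<open>t\<close> costs a factor \<open>b / t \<le> 1 + y\<close>.\<close>

lemma quotient_error:
  fixes a b s t :: real
  assumes t: "0 < t" and b: "b \<noteq> 0" and ab: "\<bar>a / b\<bar> \<le> A"
    and s: "\<bar>s - a\<bar> \<le> x * \<bar>a\<bar>" and tb: "\<bar>t - b\<bar> \<le> y * t" and x: "0 \<le> x"
  shows "\<bar>s / t - a / b\<bar> \<le> A * (x * (1 + y) + y)"
proof -
  have y: "0 \<le> y"
    using tb t by (smt (verit) mult_neg_pos)
  have A: "0 \<le> A" using ab by linarith
  have tb': "\<bar>b - t\<bar> / t \<le> y"
    using tb t by (simp add: divide_le_eq abs_minus_commute)
  have "\<bar>b / t\<bar> = \<bar>1 + (b - t) / t\<bar>"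
    using t by (simp add: field_simps)
  also have "\<dots> \<le> 1 + \<bar>(b - t) / t\<bar>"
    by linarith
  also have "\<dots> \<le> 1 + y"
    using tb' t by (simp add: abs_divide)
  finally have bt: "\<bar>b / t\<bar> \<le> 1 + y" .
  have "\<bar>(s - a) / t\<bar> \<le> x * \<bar>a\<bar> / t"
    using s t by (simp add: abs_divide divide_right_mono)
  also have "\<dots> = x * (\<bar>a / b\<bar> * \<bar>b / t\<bar>)"
    using t b by (simp add: abs_divide)
  also have "\<dots> \<le> x * (A * (1 + y))"
    using ab bt x A by (intro mult_left_mono mult_mono) auto
  finally have 1: "\<bar>(s - a) / t\<bar> \<le> A * (x * (1 + y))"
    by (simp add: mult_ac)
  have "\<bar>a / b * ((b - t) / t)\<bar> = \<bar>a / b\<bar> * (\<bar>b - t\<bar> / t)"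
    using t by (simp add: abs_mult abs_divide)
  also have "\<dots> \<le> A * y"
    using ab tb' A t by (intro mult_mono) auto
  finally have 2: "\<bar>a / b * ((b - t) / t)\<bar> \<le> A * y" .
  have "s / t - a / b = (s - a) / t + a / b * ((b - t) / t)"
    using t b by (simp add: field_simps)
  with 1 2 have "\<bar>s / t - a / b\<bar> \<le> A * (x * (1 + y)) + A * y"
    by linarith
  then show ?thesis
    by (simp only: distrib_left)
qed

text \<open>Alignment turns an error relative to the norms of a representor and of the data into one
  relative to their inner product.\<close>

lemma representor_quotient_error:
  assumes c: "C2_jordan_curve c"
    and cont: "continuous_on (path_image c) \<rho>1" "continuous_on (path_image c) \<rho>2"
      "continuous_on (path_image c) \<sigma>1" "continuous_on (path_image c) \<sigma>2"
      "continuous_on (path_image c) h"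
    and al1: "aligned \<eta>1 c \<rho>1 h" and al2: "aligned \<eta>2 c \<sigma>2 h"
    and nz: "bdry_inner c \<rho>2 h \<noteq> 0"
    and A: "\<bar>bdry_inner c \<rho>1 h / bdry_inner c \<rho>2 h\<bar> \<le> A"
  defines "e1 \<equiv> sqrt (rel_error_sq c \<sigma>1 \<rho>1 \<rho>1)" and "e2 \<equiv> sqrt (rel_error_sq c \<sigma>2 \<rho>2 \<sigma>2)"
  shows "\<bar>bdry_inner c \<sigma>1 h / bdry_inner c \<sigma>2 h - bdry_inner c \<rho>1 h / bdry_inner c \<rho>2 h\<bar>
    \<le> A * (e1 / \<eta>1 * (1 + e2 / \<eta>2) + e2 / \<eta>2)"
proof (rule quotient_error[OF _ nz A])
  note al1' = aligned_imp[OF al1] and al2' = aligned_imp[OF al2]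
  have e: "0 \<le> e1" "0 \<le> e2"
    by (simp_all add: e1_def e2_def rel_error_sq_nonneg)
  then show "0 \<le> e1 / \<eta>1"
    using al1' by simp
  have "0 < \<eta>2 * (bdry_norm c \<sigma>2 * bdry_norm c h)"
    using al2' by simp
  also note al2'(4)
  finally show "0 < bdry_inner c \<sigma>2 h" .
  have "\<bar>bdry_inner c \<sigma>1 h - bdry_inner c \<rho>1 h\<bar> \<le> e1 * (bdry_norm c \<rho>1 * bdry_norm c h)"
    unfolding e1_def using al1' by (intro bdry_inner_error c cont) auto
  also have "\<dots> \<le> e1 * (bdry_inner c \<rho>1 h / \<eta>1)"
    using al1' e by (intro mult_left_mono) (auto simp: field_simps)
  also have "\<dots> \<le> e1 / \<eta>1 * \<bar>bdry_inner c \<rho>1 h\<bar>"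
    using al1' e by (simp add: divide_right_mono mult_left_mono)
  finally show "\<bar>bdry_inner c \<sigma>1 h - bdry_inner c \<rho>1 h\<bar> \<le> e1 / \<eta>1 * \<bar>bdry_inner c \<rho>1 h\<bar>" .
  have "\<bar>bdry_inner c \<sigma>2 h - bdry_inner c \<rho>2 h\<bar> \<le> e2 * (bdry_norm c \<sigma>2 * bdry_norm c h)"
    unfolding e2_def using al2' by (intro bdry_inner_error c cont) auto
  also have "\<dots> \<le> e2 * (bdry_inner c \<sigma>2 h / \<eta>2)"
    using al2' e by (intro mult_left_mono) (auto simp: field_simps)
  finally show "\<bar>bdry_inner c \<sigma>2 h - bdry_inner c \<rho>2 h\<bar> \<le> e2 / \<eta>2 * bdry_inner c \<sigma>2 h"
    by simp
qed

text \<open>The representors are applied to the boundary data of the micro problem, whose Stokes velocity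
  defines the slip amount.\<close>

lemma slip_eq_quotient:
  assumes "micro_problem P \<epsilon> \<omega> x"
  defines "c \<equiv> micro_curve P \<epsilon> \<omega> x" and "h \<equiv> micro_data P \<epsilon> \<omega> x"
  shows "slip P \<epsilon> \<omega> x = - (bdry_inner c (r1 P \<epsilon> \<omega> x) h / bdry_inner c (r2 P \<epsilon> \<omega> x) h)"
    and "bdry_inner c (r2 P \<epsilon> \<omega> x) h \<noteq> 0"
proof -
  have rep: "bdry_inner c r h = \<Lambda> (micro_vel P \<epsilon> \<omega> x)" if "representor c \<Lambda> r" for \<Lambda> r
    using assms that unfolding micro_problem_def representor_def c_def h_def micro_bdry_def micro_dom_def
    by blast
  have r1: "bdry_inner c (r1 P \<epsilon> \<omega> x) h = seg_velocity (micro_seg P \<epsilon> \<omega> x) (micro_vel P \<epsilon> \<omega> x)"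
    and r2: "bdry_inner c (r2 P \<epsilon> \<omega> x) h = seg_shear (micro_seg P \<epsilon> \<omega> x) (micro_vel P \<epsilon> \<omega> x)"
    using assms(1) by (intro rep; simp add: micro_problem_def c_def)+
  show "slip P \<epsilon> \<omega> x = - (bdry_inner c (r1 P \<epsilon> \<omega> x) h / bdry_inner c (r2 P \<epsilon> \<omega> x) h)"
    unfolding r1 r2 slip_def ..
  show "bdry_inner c (r2 P \<epsilon> \<omega> x) h \<noteq> 0"
    unfolding r2 using assms by (simp add: micro_problem_def)
qed

lemma slip_error:
  assumes mp: "micro_problem P \<epsilon> \<omega> x"
  defines "c \<equiv> micro_curve P \<epsilon> \<omega> x" and "h \<equiv> micro_data P \<epsilon> \<omega> x"
  assumes al: "aligned (\<gamma>1 / \<gamma>2) c (r1 P \<epsilon> \<omega> x) h" "aligned (1 / \<gamma>2) c (s2 P \<epsilon> \<omega> x) h"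
    and bd: "\<bar>bdry_inner c (r1 P \<epsilon> \<omega> x) h / bdry_inner c (r2 P \<epsilon> \<omega> x) h\<bar> \<le> \<gamma>1 * K"
    and pos: "0 < \<gamma>1"
  defines "e1 \<equiv> sqrt (rel_error_sq c (s1 P \<epsilon> \<omega> x) (r1 P \<epsilon> \<omega> x) (r1 P \<epsilon> \<omega> x))"
    and "e2 \<equiv> sqrt (rel_error_sq c (s2 P \<epsilon> \<omega> x) (r2 P \<epsilon> \<omega> x) (s2 P \<epsilon> \<omega> x))"
  shows "\<bar>approx_slip P \<epsilon> \<omega> x - slip P \<epsilon> \<omega> x\<bar> \<le> K * \<gamma>2 * (e1 * (1 + \<gamma>2 * e2) + \<gamma>1 * e2)"
proof -
  have "\<bar>approx_slip P \<epsilon> \<omega> x - slip P \<epsilon> \<omega> x\<bar>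
      = \<bar>bdry_inner c (s1 P \<epsilon> \<omega> x) h / bdry_inner c (s2 P \<epsilon> \<omega> x) h
         - bdry_inner c (r1 P \<epsilon> \<omega> x) h / bdry_inner c (r2 P \<epsilon> \<omega> x) h\<bar>"
    unfolding slip_eq_quotient(1)[OF mp] approx_slip_def c_def h_def by linarith
  also have "\<dots> \<le> \<gamma>1 * K * (e1 / (\<gamma>1 / \<gamma>2) * (1 + e2 / (1 / \<gamma>2)) + e2 / (1 / \<gamma>2))"
    unfolding e1_def e2_def
  proof (rule representor_quotient_error[OF _ _ _ _ _ _ al _ bd])
    show "bdry_inner c (r2 P \<epsilon> \<omega> x) h \<noteq> 0"
      unfolding c_def h_def by (rule slip_eq_quotient(2)[OF mp])
  qed (use mp in \<open>auto simp: micro_problem_def representor_def micro_bdry_def c_def h_def\<close>)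
  also have "\<dots> = K * \<gamma>2 * (e1 * (1 + \<gamma>2 * e2) + \<gamma>1 * e2)"
    using pos by (simp add: field_simps)
  finally show ?thesis .
qed

section \<open>The expected maximal error over the sample points\<close>

lemma sqrt_le_mean:
  fixes u d :: real
  assumes "0 \<le> u" "0 < d"
  shows "sqrt u \<le> (u / d + d) / 2"
proof -
  have "0 \<le> (sqrt u - d)\<^sup>2" by simp
  also have "\<dots> = u + d\<^sup>2 - 2 * d * sqrt u"
    using assms by (simp add: power2_diff)
  finally show ?thesis
    using assms by (simp add: field_simps power2_eq_square)
qed

text \<open>The bound is affine in the squared errors \<open>p n\<close> and \<open>q n\<close>, so that its expectation needs
  only their expectations. The weights \<open>d\<close> and \<open>sqrt N * d\<close> in the means are the sizes expected of
  \<open>sqrt (p n)\<close> and of the Euclidean norm of the \<open>sqrt (q n)\<close>, for which the mean loses nothing. The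
  last term uses this norm instead of a sum, which saves a factor \<open>sqrt N\<close> next to \<open>g1\<close>.\<close>

lemma max_error_le:
  fixes p q e :: "nat \<Rightarrow> real"
  assumes "1 \<le> N" and d: "0 < d" and g: "0 < g1" "0 < g2"
    and p: "\<And>n. 0 \<le> p n" and q: "\<And>n. 0 \<le> q n"
    and e: "\<And>n. n \<in> {1..N} \<Longrightarrow>
      e n \<le> sqrt (p n) * (1 + g2 * sqrt (q n)) + g1 * sqrt (q n)"
  shows "Max (e ` {1..N}) \<le> (\<Sum>n=1..N. (p n / d + d) / 2 + g2 * ((p n + q n) / 2))
    + g1 * (((\<Sum>n=1..N. q n) / (sqrt N * d) + sqrt N * d) / 2)"
proof -
  define a where "a n = (p n / d + d) / 2 + g2 * ((p n + q n) / 2)" for n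
  have a: "0 \<le> a n" for n
    using p[of n] q[of n] d g by (simp add: a_def)
  have "e n \<le> (\<Sum>n=1..N. a n) + g1 * (((\<Sum>n=1..N. q n) / (sqrt N * d) + sqrt N * d) / 2)"
    if n: "n \<in> {1..N}" for n
  proof -
    have "sqrt (p n) * sqrt (q n) \<le> (p n + q n) / 2"
      using arith_geo_mean_sqrt[OF p[of n] q[of n]] by (simp add: real_sqrt_mult)
    then have "g2 * (sqrt (p n) * sqrt (q n)) \<le> g2 * ((p n + q n) / 2)"
      using g by (intro mult_left_mono) auto
    with sqrt_le_mean[OF p[of n] d] have "sqrt (p n) + g2 * (sqrt (p n) * sqrt (q n)) \<le> a n"
      unfolding a_def by linarith
    then have "sqrt (p n) * (1 + g2 * sqrt (q n)) \<le> a n"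
      by (simp add: algebra_simps)
    also have "\<dots> \<le> (\<Sum>n=1..N. a n)"
      using n a by (intro member_le_sum) auto
    finally have 1: "sqrt (p n) * (1 + g2 * sqrt (q n)) \<le> (\<Sum>n=1..N. a n)" .
    have "sqrt (q n) \<le> sqrt (\<Sum>n=1..N. q n)"
      using n q by (intro real_sqrt_le_mono member_le_sum) auto
    also have "\<dots> \<le> ((\<Sum>n=1..N. q n) / (sqrt N * d) + sqrt N * d) / 2"
      using q d assms(1) by (intro sqrt_le_mean sum_nonneg) auto
    finally have "g1 * sqrt (q n) \<le> g1 * (((\<Sum>n=1..N. q n) / (sqrt N * d) + sqrt N * d) / 2)"
      using g by (intro mult_left_mono) auto
    with 1 e[OF n] show ?thesis by linarith
  qed
  then show ?thesis
    unfolding a_def using assms(1) by (subst Max_le_iff) auto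
qed

text \<open>The affine majorant of the maximum serves both claims: it dominates \<open>F\<close>, which makes \<open>F\<close>
  integrable, and its expectation is computed term by term.\<close>

lemma (in prob_space) expectation_le_of_max_error:
  fixes p q :: "nat \<Rightarrow> 'a \<Rightarrow> real" and e :: "nat \<Rightarrow> 'a \<Rightarrow> real"
  assumes N: "1 \<le> N" and pos: "0 < d" "0 < g1" "0 < g2" "0 \<le> k"
    and p: "\<And>n \<omega>. 0 \<le> p n \<omega>" and q: "\<And>n \<omega>. 0 \<le> q n \<omega>"
    and ip: "\<And>n. n \<in> {1..N} \<Longrightarrow> integrable M (p n)" and Ep: "\<And>n. n \<in> {1..N} \<Longrightarrow> expectation (p n) \<le> d\<^sup>2"
    and iq: "\<And>n. n \<in> {1..N} \<Longrightarrow> integrable M (q n)" and Eq: "\<And>n. n \<in> {1..N} \<Longrightarrow> expectation (q n) \<le> d\<^sup>2"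
    and e: "\<And>n. n \<in> {1..N} \<Longrightarrow>
      AE \<omega> in M. e n \<omega> \<le> sqrt (p n \<omega>) * (1 + g2 * sqrt (q n \<omega>)) + g1 * sqrt (q n \<omega>)"
    and F: "F \<in> borel_measurable M" "\<And>\<omega>. \<omega> \<in> space M \<Longrightarrow> 0 \<le> F \<omega>"
      "\<And>\<omega>. \<omega> \<in> space M \<Longrightarrow> F \<omega> \<le> b + k * Max ((\<lambda>n. e n \<omega>) ` {1..N})"
  shows "integrable M F" and "expectation F \<le> b + k * (N * d * (1 + g2 * d) + g1 * (sqrt N * d))"
proof -
  define G where "G \<omega> = b + k * ((\<Sum>n=1..N. (p n \<omega> / d + d) / 2 + g2 * ((p n \<omega> + q n \<omega>) / 2))
    + g1 * (((\<Sum>n=1..N. q n \<omega>) / (sqrt N * d) + sqrt N * d) / 2))" for \<omega>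
  have iG: "integrable M G"
    unfolding G_def
    by (intro Bochner_Integration.integrable_add integrable_const Bochner_Integration.integrable_sum
      integrable_mult_right integrable_divide ip iq)
  have "AE \<omega> in M. \<forall>n\<in>{1..N}. e n \<omega> \<le> sqrt (p n \<omega>) * (1 + g2 * sqrt (q n \<omega>)) + g1 * sqrt (q n \<omega>)"
    using e by (intro AE_finite_allI) auto
  then have FG: "AE \<omega> in M. F \<omega> \<le> G \<omega>"
  proof (rule AE_mp, intro AE_I2 impI)
    fix \<omega> assume \<omega>: "\<omega> \<in> space M" and
      *: "\<forall>n\<in>{1..N}. e n \<omega> \<le> sqrt (p n \<omega>) * (1 + g2 * sqrt (q n \<omega>)) + g1 * sqrt (q n \<omega>)"
    have "Max ((\<lambda>n. e n \<omega>) ` {1..N}) \<le> (\<Sum>n=1..N. (p n \<omega> / d + d) / 2 + g2 * ((p n \<omega> + q n \<omega>) / 2))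
    + g1 * (((\<Sum>n=1..N. q n \<omega>) / (sqrt N * d) + sqrt N * d) / 2)"
      using * by (intro max_error_le N pos p q) auto
    with F(3)[OF \<omega>] pos(4) show "F \<omega> \<le> G \<omega>"
      unfolding G_def by (smt (verit) mult_left_mono)
  qed
  show iF: "integrable M F"
    using FG F(2) by (intro Bochner_Integration.integrable_bound[OF iG F(1)]) (auto elim!: AE_mp)
  have "expectation F \<le> expectation G"
    by (rule integral_mono_AE[OF iF iG FG])
  also have "expectation G = b + k * ((\<Sum>n=1..N. (expectation (p n) / d + d) / 2 + g2 * ((expectation (p n) + expectation (q n)) / 2))
    + g1 * (((\<Sum>n=1..N. expectation (q n)) / (sqrt N * d) + sqrt N * d) / 2))"
  proof -
    have ia: "integrable M (\<lambda>\<omega>. (p n \<omega> / d + d) / 2 + g2 * ((p n \<omega> + q n \<omega>) / 2))"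
      and Ea: "expectation (\<lambda>\<omega>. (p n \<omega> / d + d) / 2 + g2 * ((p n \<omega> + q n \<omega>) / 2))
        = (expectation (p n) / d + d) / 2 + g2 * ((expectation (p n) + expectation (q n)) / 2)"
      if "n \<in> {1..N}" for n
      using ip[OF that] iq[OF that] by (simp_all add: prob_space)
    have 1: "integrable M (\<lambda>\<omega>. \<Sum>n=1..N. (p n \<omega> / d + d) / 2 + g2 * ((p n \<omega> + q n \<omega>) / 2))"
      "integrable M (\<lambda>\<omega>. \<Sum>n=1..N. q n \<omega>)"
      using ia iq by (intro Bochner_Integration.integrable_sum; blast)+
    have 2: "expectation (\<lambda>\<omega>. \<Sum>n=1..N. (p n \<omega> / d + d) / 2 + g2 * ((p n \<omega> + q n \<omega>) / 2))
        = (\<Sum>n=1..N. (expectation (p n) / d + d) / 2 + g2 * ((expectation (p n) + expectation (q n)) / 2))"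
      "expectation (\<lambda>\<omega>. \<Sum>n=1..N. q n \<omega>) = (\<Sum>n=1..N. expectation (q n))"
      using ia iq Ea by (subst Bochner_Integration.integral_sum; force)+
    show ?thesis
      unfolding G_def 2[symmetric] using 1
      by (simp add: prob_space del: Bochner_Integration.integral_sum sum.cl_ivl_Suc)
  qed
  also have "\<dots> \<le> b + k * ((\<Sum>n=1..N. (d\<^sup>2 / d + d) / 2 + g2 * ((d\<^sup>2 + d\<^sup>2) / 2))
    + g1 * (((\<Sum>n=1..N. d\<^sup>2) / (sqrt N * d) + sqrt N * d) / 2))"
    using pos Ep Eq
    by (intro add_left_mono mult_left_mono add_mono sum_mono divide_right_mono order_refl) auto
  also have "\<dots> = b + k * (N * d * (1 + g2 * d) + g1 * (sqrt N * d))"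
  proof -
    have "real N * d\<^sup>2 / (sqrt N * d) = sqrt N * d"
      using pos N by (simp add: field_simps power2_eq_square flip: real_sqrt_mult_self[of N])
    then show ?thesis
      using pos by (simp add: power2_eq_square algebra_simps)
  qed
  finally show "expectation F \<le> b + k * (N * d * (1 + g2 * d) + g1 * (sqrt N * d))" .
qed

section \<open>Interpolation\<close>

text \<open>By continuity the supremum may be taken over a countable dense subset of \<open>K\<close>.\<close>

lemma borel_measurable_SUP_continuous_on:
  fixes f :: "'w \<Rightarrow> 'a::euclidean_space \<Rightarrow> real"
  assumes K: "compact K" "K \<noteq> {}"
    and cont: "\<And>\<omega>. \<omega> \<in> space M \<Longrightarrow> continuous_on K (f \<omega>)"
    and meas: "\<And>z. z \<in> K \<Longrightarrow> (\<lambda>\<omega>. f \<omega> z) \<in> borel_measurable M"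
  shows "(\<lambda>\<omega>. SUP z\<in>K. f \<omega> z) \<in> borel_measurable M"
proof -
  obtain D where D: "countable D" "D \<subseteq> K" "K \<subseteq> closure D"
    using separable by blast
  then have "D \<noteq> {}"
    using K(2) by auto
  have "closure D = K"
    using D K(1) by (meson closure_minimal compact_imp_closed subset_antisym)
  have bdd: "bdd_above (f \<omega> ` K)" if "\<omega> \<in> space M" for \<omega>
    using compact_continuous_image[OF cont[OF that] K(1)]
    by (intro bounded_imp_bdd_above compact_imp_bounded)
  have "(SUP z\<in>K. f \<omega> z) = (SUP z\<in>D. f \<omega> z)" if \<omega>: "\<omega> \<in> space M" for \<omega>
  proof (rule antisym)
    have bddD: "bdd_above (f \<omega> ` D)"
      using bdd[OF \<omega>] D(2) by (meson bdd_above_mono image_mono)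
    have "f \<omega> z \<le> (SUP z\<in>D. f \<omega> z)" if "z \<in> K" for z
    proof (rule continuous_le_on_closure[of D "f \<omega>"])
      show "continuous_on (closure D) (f \<omega>)" "z \<in> closure D"
        using cont[OF \<omega>] that \<open>closure D = K\<close> by auto
    qed (use bddD in \<open>auto intro: cSUP_upper\<close>)
    then show "(SUP z\<in>K. f \<omega> z) \<le> (SUP z\<in>D. f \<omega> z)"
      using K(2) by (intro cSUP_least)
    show "(SUP z\<in>D. f \<omega> z) \<le> (SUP z\<in>K. f \<omega> z)"
      using bdd[OF \<omega>] D(2) \<open>D \<noteq> {}\<close> by (intro cSUP_subset_mono) auto
  qed
  moreover have "(\<lambda>\<omega>. SUP z\<in>D. f \<omega> z) \<in> borel_measurable M"
  proof (rule borel_measurable_cSUP[OF D(1)])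
    show "bdd_above ((\<lambda>z. f \<omega> z) ` D)" if "\<omega> \<in> space M" for \<omega>
      using bdd[OF that] D(2) by (meson bdd_above_mono image_mono)
  qed (use meas D in auto)
  ultimately show ?thesis
    by (simp cong: measurable_cong)
qed

text \<open>This expresses an interpolated random function as a finite combination of random variables,
  and so makes it measurable. The bound on the operator annihilates a sequence that vanishes at the
  indices \<open>{1..N}\<close>.\<close>

lemma interpolant_eq_sum:
  assumes I: "interpolant K N x CI I" and z: "z \<in> K" and "1 \<le> N"
  shows "I a z = (\<Sum>n=1..N. a n * I (\<lambda>j. if j = n then 1 else 0) z)"
proof -
  have add: "I (\<lambda>n. a n + b n) z = I a z + I b z" and scale: "I (\<lambda>n. s * a n) z = s * I a z"
    and bound: "\<bar>I a z\<bar> \<le> CI * Max ((\<lambda>n. \<bar>a n\<bar>) ` {1..N})" for a b s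
    using I z unfolding interpolant_def by blast+
  have zero: "I a z = 0" if "\<And>n. n \<in> {1..N} \<Longrightarrow> a n = 0" for a
  proof -
    have "(\<lambda>n. \<bar>a n\<bar>) ` {1..N} = {0}"
      using that \<open>1 \<le> N\<close> by force
    then show ?thesis using bound[of a] by simp
  qed
  have sum: "I (\<lambda>j. \<Sum>n\<in>A. a n * (if j = n then 1 else 0)) z
      = (\<Sum>n\<in>A. a n * I (\<lambda>j. if j = n then 1 else 0) z)" if "finite A" for A
    using that by induction (simp_all add: add scale zero)
  define b where "b = (\<lambda>j. \<Sum>n=1..N. a n * (if j = n then 1 else 0))"
  have "I a z = I (\<lambda>j. b j + (a j - b j)) z" by simp
  also have "\<dots> = I b z + I (\<lambda>j. a j - b j) z" by (rule add)
  also have "I (\<lambda>j. a j - b j) z = 0"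
  proof (rule zero)
    fix n assume "n \<in> {1..N}"
    then show "a n - b n = 0"
      by (simp add: b_def if_distrib[of "(*) _"] cong: if_cong)
  qed
  finally show ?thesis
    using sum[of "{1..N}"] by (simp add: b_def)
qed

text \<open>By linearity the error splits into that of interpolating exact values and the interpolant of
  the errors in the values.\<close>

lemma interpolation_error:
  assumes I: "interpolant K N x CI I" and tight: "tightly_interpolates K N x CI I L f"
    and res: "resolution K N x \<le> r" and CI: "0 < CI" and z: "z \<in> K"
  shows "\<bar>I a z - f z\<bar> \<le> CI * L * r + CI * Max ((\<lambda>n. \<bar>a n - f (x n)\<bar>) ` {1..N})"
proof -
  have add: "I (\<lambda>n. b n + c n) z = I b z + I c z"
    and bound: "\<bar>I b z\<bar> \<le> CI * Max ((\<lambda>n. \<bar>b n\<bar>) ` {1..N})" for b c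
    using I z unfolding interpolant_def by blast+
  have "I a z = I (\<lambda>n. (a n - f (x n)) + f (x n)) z" by simp
  also have "\<dots> = I (\<lambda>n. a n - f (x n)) z + I (\<lambda>n. f (x n)) z"
    by (rule add)
  finally have "\<bar>I a z - f z\<bar> \<le> \<bar>I (\<lambda>n. a n - f (x n)) z\<bar> + \<bar>I (\<lambda>n. f (x n)) z - f z\<bar>"
    by linarith
  also have "\<bar>I (\<lambda>n. a n - f (x n)) z\<bar> \<le> CI * Max ((\<lambda>n. \<bar>a n - f (x n)\<bar>) ` {1..N})"
    by (rule bound)
  also have "\<bar>I (\<lambda>n. f (x n)) z - f z\<bar> \<le> CI * L * resolution K N x"
    using tight z unfolding tightly_interpolates_def by blast
  also have "\<dots> \<le> CI * L * r"
    using tight res CI by (intro mult_left_mono) (auto simp: tightly_interpolates_def)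
  finally show ?thesis by simp
qed

section \<open>The choice of the number of sample points\<close>

text \<open>With \<open>m = sqrt (g1 * l / (g2 * g3 * d))\<close> both \<open>g1 / g3 * (l / m)\<close> and \<open>m * g2 * d\<close> equal
  the square root expression on the right. Rounding \<open>m\<close> up costs at most a factor \<open>2\<close> because
  \<open>1 \<le> m\<close>, and \<open>g1\<^sup>2 \<le> m\<close> absorbs the factor \<open>g1\<close> into \<open>sqrt N\<close>.\<close>

lemma balanced_error:
  fixes g1 g2 g3 l d :: real
  assumes pos: "0 < g1" "0 < g2" "0 < g3" "0 < l" "0 < d" and acc: "accurate g1 g2 g3 l d"
  defines "N \<equiv> nat \<lceil>sqrt (g1 * l / (g2 * g3 * d))\<rceil>"
  shows "1 \<le> N"
    and "g1 / g3 * (l / N) + g2 * (N * d * (1 + g2 * d) + g1 * (sqrt N * d))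
      \<le> 7 * (g1 * sqrt (d * l * g2 / (g1 * g3)))"
proof -
  define m where "m = sqrt (g1 * l / (g2 * g3 * d))"
  define T where "T = g1 * sqrt (d * l * g2 / (g1 * g3))"
  have m1: "1 \<le> m" and m2: "g1\<^sup>2 \<le> m" and d: "g2 * d \<le> 1"
    using acc pos by (simp_all add: accurate_def m_def pos_le_divide_eq mult.commute)
  have N: "m \<le> N" "N \<le> 2 * m" "1 \<le> real N"
    using m1 unfolding N_def m_def[symmetric] by linarith+
  then show "1 \<le> N" by simp
  have mm: "m * m = g1 * l / (g2 * g3 * d)"
    using pos by (simp add: m_def)
  have T1: "m * g2 * d = T"
  proof -
    have "(m * g2 * d)\<^sup>2 = T\<^sup>2"
    proof -
      have "(m * g2 * d)\<^sup>2 = m * m * (g2 * d)\<^sup>2"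
        by (simp only: power2_eq_square mult_ac)
      also have "\<dots> = g1 * l * g2 * d / g3"
        unfolding mm using pos by (simp add: power2_eq_square)
      also have "\<dots> = g1\<^sup>2 * (d * l * g2 / (g1 * g3))"
        using pos by (simp add: power2_eq_square)
      also have "\<dots> = T\<^sup>2"
        using pos by (simp add: T_def power_mult_distrib)
      finally show ?thesis .
    qed
    moreover have "0 \<le> m * g2 * d" "0 \<le> T"
      using pos m1 by (simp_all add: T_def)
    ultimately show ?thesis
      by (rule power2_eq_imp_eq)
  qed
  have "g1 / g3 * (l / m) = m * m * g2 * d / m"
    unfolding mm using pos by simp
  with m1 T1 have T2: "g1 / g3 * (l / m) = T"
    by simp
  have "g1 / g3 * (l / N) \<le> g1 / g3 * (l / m)"
    using pos m1 N by (intro mult_left_mono divide_left_mono) auto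
  with T2 have 1: "g1 / g3 * (l / N) \<le> T" by simp
  have "g1 \<le> sqrt N"
    using m2 N by (intro real_le_rsqrt) linarith
  then have "g1 * (sqrt N * d) \<le> sqrt N * (sqrt N * d)"
    using pos by (intro mult_right_mono) auto
  also have "\<dots> = N * d" by (simp flip: mult.assoc)
  finally have "N * d * (1 + g2 * d) + g1 * (sqrt N * d) \<le> N * d * 2 + N * d"
    using d pos by (intro add_mono mult_left_mono) auto
  then have "g2 * (N * d * (1 + g2 * d) + g1 * (sqrt N * d)) \<le> g2 * (N * d * 2 + N * d)"
    using pos by (intro mult_left_mono) auto
  also have "\<dots> = 3 * (N * g2 * d)" by simp
  also have "\<dots> \<le> 3 * (2 * m * g2 * d)"
    using N pos by (intro mult_left_mono mult_right_mono) auto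
  also have "\<dots> = 6 * T" using T1 by simp
  finally show "g1 / g3 * (l / N) + g2 * (N * d * (1 + g2 * d) + g1 * (sqrt N * d))
      \<le> 7 * (g1 * sqrt (d * l * g2 / (g1 * g3)))"
    using 1 unfolding T_def by linarith
qed

section \<open>The expected error along the wall\<close>

lemma compact_wall:
  assumes "rough_problem P"
  shows "compact (wall P)" "wall P \<noteq> {}"
proof -
  have w: "smooth_wall (macro_dom P) (wall_curve P) (wall_length P) (wall_normal P)"
    using assms by (simp add: rough_problem_def)
  then have "C_k 0 UNIV (wall_curve P)"
    by (simp only: smooth_wall_def smooth_on_def)
  then have "continuous_on {0..wall_length P} (wall_curve P)"
    using continuous_on_subset by fastforce
  then show "compact (wall P)"
    unfolding wall_def by (intro compact_continuous_image) auto
  show "wall P \<noteq> {}"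
    using w by (auto simp: wall_def smooth_wall_def)
qed

lemma borel_measurable_slips:
  assumes P: "rough_problem P" and "0 < \<epsilon>" "x \<in> wall P"
  shows "(\<lambda>\<omega>. slip P \<epsilon> \<omega> x) \<in> borel_measurable (prob P)"
    and "(\<lambda>\<omega>. approx_slip P \<epsilon> \<omega> x) \<in> borel_measurable (prob P)"
proof -
  have meas: "(\<lambda>\<omega>. bdry_inner (micro_curve P \<epsilon> \<omega> x) (f \<epsilon> \<omega> x) (micro_data P \<epsilon> \<omega> x))
      \<in> borel_measurable (prob P)" if "f \<in> {r1 P, r2 P, s1 P, s2 P}" for f
    using assms that unfolding rough_problem_def by blast
  have "(\<lambda>\<omega>. - (bdry_inner (micro_curve P \<epsilon> \<omega> x) (r1 P \<epsilon> \<omega> x) (micro_data P \<epsilon> \<omega> x)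
      / bdry_inner (micro_curve P \<epsilon> \<omega> x) (r2 P \<epsilon> \<omega> x) (micro_data P \<epsilon> \<omega> x))) \<in> borel_measurable (prob P)"
    by (intro borel_measurable_uminus borel_measurable_divide meas) auto
  moreover have "slip P \<epsilon> \<omega> x = - (bdry_inner (micro_curve P \<epsilon> \<omega> x) (r1 P \<epsilon> \<omega> x) (micro_data P \<epsilon> \<omega> x)
      / bdry_inner (micro_curve P \<epsilon> \<omega> x) (r2 P \<epsilon> \<omega> x) (micro_data P \<epsilon> \<omega> x))" if "\<omega> \<in> space (prob P)" for \<omega>
    using assms that by (intro slip_eq_quotient(1)) (auto simp: rough_problem_def)
  ultimately show "(\<lambda>\<omega>. slip P \<epsilon> \<omega> x) \<in> borel_measurable (prob P)"
    by (simp cong: measurable_cong)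
  show "(\<lambda>\<omega>. approx_slip P \<epsilon> \<omega> x) \<in> borel_measurable (prob P)"
    unfolding approx_slip_def by (intro borel_measurable_uminus borel_measurable_divide meas) auto
qed

lemma expected_interpolated_slip_error:
  assumes P: "rough_problem P" and \<epsilon>: "0 < \<epsilon>"
    and pos: "0 < g1" "0 < g2" "0 < g3" "0 < d" "0 < K" "0 < CI" and N: "1 \<le> N"
    and al1: "\<And>x. x \<in> wall P \<Longrightarrow> AE \<omega> in prob P.
      aligned (g1 / g2) (micro_curve P \<epsilon> \<omega> x) (r1 P \<epsilon> \<omega> x) (micro_data P \<epsilon> \<omega> x)"
    and al2: "\<And>x. x \<in> wall P \<Longrightarrow> AE \<omega> in prob P.
      aligned (1 / g2) (micro_curve P \<epsilon> \<omega> x) (s2 P \<epsilon> \<omega> x) (micro_data P \<epsilon> \<omega> x)"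
    and bd: "\<And>x. x \<in> wall P \<Longrightarrow> AE \<omega> in prob P.
      \<bar>bdry_inner (micro_curve P \<epsilon> \<omega> x) (r1 P \<epsilon> \<omega> x) (micro_data P \<epsilon> \<omega> x)
       / bdry_inner (micro_curve P \<epsilon> \<omega> x) (r2 P \<epsilon> \<omega> x) (micro_data P \<epsilon> \<omega> x)\<bar> \<le> g1 * K"
    and e1: "\<And>x. x \<in> wall P \<Longrightarrow> integrable (prob P)
        (\<lambda>\<omega>. rel_error_sq (micro_curve P \<epsilon> \<omega> x) (s1 P \<epsilon> \<omega> x) (r1 P \<epsilon> \<omega> x) (r1 P \<epsilon> \<omega> x))"
      "\<And>x. x \<in> wall P \<Longrightarrow> prob_space.expectation (prob P)
        (\<lambda>\<omega>. rel_error_sq (micro_curve P \<epsilon> \<omega> x) (s1 P \<epsilon> \<omega> x) (r1 P \<epsilon> \<omega> x) (r1 P \<epsilon> \<omega> x)) \<le> d\<^sup>2"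
    and e2: "\<And>x. x \<in> wall P \<Longrightarrow> integrable (prob P)
        (\<lambda>\<omega>. rel_error_sq (micro_curve P \<epsilon> \<omega> x) (s2 P \<epsilon> \<omega> x) (r2 P \<epsilon> \<omega> x) (s2 P \<epsilon> \<omega> x))"
      "\<And>x. x \<in> wall P \<Longrightarrow> prob_space.expectation (prob P)
        (\<lambda>\<omega>. rel_error_sq (micro_curve P \<epsilon> \<omega> x) (s2 P \<epsilon> \<omega> x) (r2 P \<epsilon> \<omega> x) (s2 P \<epsilon> \<omega> x)) \<le> d\<^sup>2"
    and x: "x ` {1..N} \<subseteq> wall P" and res: "resolution (wall P) N x \<le> r"
    and I: "interpolant (wall P) N x CI I"
    and tight: "\<And>\<omega>. \<omega> \<in> space (prob P) \<Longrightarrow>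
      tightly_interpolates (wall P) N x CI I (g1 / g3 * K) (slip P \<epsilon> \<omega>)"
  defines "F \<equiv> \<lambda>\<omega>. SUP z\<in>wall P. \<bar>I (\<lambda>n. approx_slip P \<epsilon> \<omega> (x n)) z - slip P \<epsilon> \<omega> z\<bar>"
  shows "integrable (prob P) F"
    and "prob_space.expectation (prob P) F
      \<le> CI * K * (g1 / g3 * r + g2 * (N * d * (1 + g2 * d) + g1 * (sqrt N * d)))"
proof -
  interpret Pr: prob_space "prob P"
    using P by (simp add: rough_problem_def)
  define f where "f = (\<lambda>\<omega> z. \<bar>I (\<lambda>n. approx_slip P \<epsilon> \<omega> (x n)) z - slip P \<epsilon> \<omega> z\<bar>)"
  define E where "E n \<omega> = \<bar>approx_slip P \<epsilon> \<omega> (x n) - slip P \<epsilon> \<omega> (x n)\<bar>" for n \<omega>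
  define p where "p n \<omega> = rel_error_sq (micro_curve P \<epsilon> \<omega> (x n))
    (s1 P \<epsilon> \<omega> (x n)) (r1 P \<epsilon> \<omega> (x n)) (r1 P \<epsilon> \<omega> (x n))" for n \<omega>
  define q where "q n \<omega> = rel_error_sq (micro_curve P \<epsilon> \<omega> (x n))
    (s2 P \<epsilon> \<omega> (x n)) (r2 P \<epsilon> \<omega> (x n)) (s2 P \<epsilon> \<omega> (x n))" for n \<omega>
  have F: "F = (\<lambda>\<omega>. SUP z\<in>wall P. f \<omega> z)"
    by (simp add: F_def f_def)
  note K = compact_wall[OF P]
  have xw: "x n \<in> wall P" if "n \<in> {1..N}" for n
    using x that by blast
  have cont: "continuous_on (wall P) (f \<omega>)" if "\<omega> \<in> space (prob P)" for \<omega>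
  proof -
    have "continuous_on (wall P) (slip P \<epsilon> \<omega>)"
      using tight[OF that] unfolding tightly_interpolates_def by (meson lipschitz_on_continuous_on)
    moreover have "continuous_on (wall P) (I a)" for a
      using I by (simp add: interpolant_def)
    ultimately show ?thesis
      unfolding f_def by (intro continuous_intros)
  qed
  have Fmeas: "F \<in> borel_measurable (prob P)"
    unfolding F
  proof (rule borel_measurable_SUP_continuous_on[OF K cont])
    fix z assume z: "z \<in> wall P"
    note interpolant_eq_sum[OF I z N, of "\<lambda>n. approx_slip P \<epsilon> _ (x n)"]
    moreover have "(\<lambda>\<omega>. \<bar>(\<Sum>n=1..N. approx_slip P \<epsilon> \<omega> (x n) * I (\<lambda>j. if j = n then 1 else 0) z)
        - slip P \<epsilon> \<omega> z\<bar>) \<in> borel_measurable (prob P)"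
      using borel_measurable_slips[OF P \<epsilon>] xw z
      by (intro borel_measurable_abs borel_measurable_diff borel_measurable_sum
        borel_measurable_times borel_measurable_const) auto
    ultimately show "(\<lambda>\<omega>. f \<omega> z) \<in> borel_measurable (prob P)"
      unfolding f_def by (simp only:)
  qed
  have upper: "f \<omega> z \<le> CI * (g1 / g3 * K) * r + CI * Max ((\<lambda>n. E n \<omega>) ` {1..N})"
    if "\<omega> \<in> space (prob P)" "z \<in> wall P" for \<omega> z
    unfolding f_def E_def using interpolation_error[OF I tight[OF that(1)] res pos(6) that(2)] .
  have F_upper: "F \<omega> \<le> CI * (g1 / g3 * K) * r + (CI * K * g2) * Max ((\<lambda>n. E n \<omega> / (K * g2)) ` {1..N})"
    if "\<omega> \<in> space (prob P)" for \<omega>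
  proof -
    \<comment> \<open>The common factor of the pointwise error bounds is moved out of the maximum.\<close>
    have "Max ((\<lambda>n. E n \<omega>) ` {1..N}) \<le> K * g2 * Max ((\<lambda>n. E n \<omega> / (K * g2)) ` {1..N})"
    proof -
      have "E n \<omega> \<le> K * g2 * Max ((\<lambda>n. E n \<omega> / (K * g2)) ` {1..N})" if "n \<in> {1..N}" for n
      proof -
        have "E n \<omega> / (K * g2) \<le> Max ((\<lambda>n. E n \<omega> / (K * g2)) ` {1..N})"
          using that by (intro Max_ge) auto
        then show ?thesis using pos by (simp add: field_simps)
      qed
      then show ?thesis using N by (subst Max_le_iff) auto
    qed
    then have "CI * Max ((\<lambda>n. E n \<omega>) ` {1..N}) \<le> CI * (K * g2 * Max ((\<lambda>n. E n \<omega> / (K * g2)) ` {1..N}))"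
      using pos by (intro mult_left_mono) auto
    with upper[OF that] show ?thesis
      unfolding F using K(2) by (intro cSUP_least) (force simp: mult.assoc)+
  qed
  have F_nonneg: "0 \<le> F \<omega>" if "\<omega> \<in> space (prob P)" for \<omega>
  proof -
    obtain z where "z \<in> wall P" using K(2) by blast
    moreover have "bdd_above (f \<omega> ` wall P)"
      using upper[OF that] by (intro bdd_aboveI2)
    ultimately have "f \<omega> z \<le> F \<omega>"
      unfolding F by (intro cSUP_upper)
    then show ?thesis by (simp add: f_def)
  qed
  have E: "AE \<omega> in prob P. E n \<omega> / (K * g2)
      \<le> sqrt (p n \<omega>) * (1 + g2 * sqrt (q n \<omega>)) + g1 * sqrt (q n \<omega>)" if "n \<in> {1..N}" for n
    using al1[OF xw[OF that]] al2[OF xw[OF that]] bd[OF xw[OF that]] AE_space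
  proof eventually_elim
    case (elim \<omega>)
    then have "micro_problem P \<epsilon> \<omega> (x n)"
      using P \<epsilon> xw[OF that] by (simp add: rough_problem_def)
    from slip_error[OF this elim(1-3) pos(1)] pos show ?case
      by (simp add: E_def p_def q_def pos_divide_le_eq mult.commute)
  qed
  have int: "integrable (prob P) (p n)" "Pr.expectation (p n) \<le> d\<^sup>2"
    "integrable (prob P) (q n)" "Pr.expectation (q n) \<le> d\<^sup>2" if "n \<in> {1..N}" for n
    unfolding p_def q_def using e1 e2 xw[OF that] by blast+
  have k: "0 \<le> CI * K * g2" using pos by simp
  have pq: "0 \<le> p n \<omega>" "0 \<le> q n \<omega>" for n \<omega>
    by (simp_all add: p_def q_def rel_error_sq_nonneg)
  note bound = Pr.expectation_le_of_max_error[of N d g1 g2 "CI * K * g2" p q, OF N pos(4,1,2) k pq int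
      E Fmeas F_nonneg F_upper]
  show "integrable (prob P) F"
    by (rule bound)
  show "Pr.expectation F
      \<le> CI * K * (g1 / g3 * r + g2 * (N * d * (1 + g2 * d) + g1 * (sqrt N * d)))"
    using bound(2) by (simp add: algebra_simps)
qed

text \<open>The constant collects the factor \<open>CI * C\<alpha>\<close> of both error contributions and the \<open>7\<close> lost in
  balancing them, halved because the asserted bound contains a factor \<open>2\<close>.\<close>

theorem theorem5p7:
  fixes C\<alpha> CI :: real
  assumes "0 < C\<alpha>" and "0 < CI"
  shows "\<exists>C>0. \<forall>(P :: ('w, 'q) rough_problem) (\<gamma>1 :: real \<Rightarrow> real) (\<gamma>2 :: real \<Rightarrow> real)
      (\<gamma>3 :: real \<Rightarrow> real) (\<eta>1 :: real \<Rightarrow> real) (\<eta>2 :: real \<Rightarrow> real) (\<delta> :: real \<Rightarrow> real).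
    rough_problem P \<longrightarrow>
    (\<forall>\<epsilon>>0. 0 < \<gamma>1 \<epsilon> \<and> 0 < \<gamma>2 \<epsilon> \<and> 0 < \<gamma>3 \<epsilon> \<and> 0 < \<delta> \<epsilon>) \<longrightarrow>
    ((\<lambda>\<epsilon>. \<epsilon> / \<gamma>1 \<epsilon>) \<longlongrightarrow> 0) (at_right 0) \<longrightarrow>
    ((\<lambda>\<epsilon>. \<gamma>1 \<epsilon> / \<gamma>3 \<epsilon>) \<longlongrightarrow> 0) (at_right 0) \<longrightarrow>
    ((\<lambda>\<epsilon>. \<gamma>1 \<epsilon> / \<gamma>2 \<epsilon>) \<longlongrightarrow> 0) (at_right 0) \<longrightarrow>
    ((\<lambda>\<epsilon>. \<gamma>2 \<epsilon> / (\<gamma>1 \<epsilon> * \<gamma>3 \<epsilon>)) \<longlongrightarrow> 0) (at_right 0) \<longrightarrow>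
    (\<forall>\<epsilon>>0. \<eta>1 \<epsilon> = \<gamma>1 \<epsilon> / \<gamma>2 \<epsilon> \<and> \<eta>2 \<epsilon> = 1 / \<gamma>2 \<epsilon>) \<longrightarrow>
    (\<forall>\<epsilon>>0. \<forall>\<omega>\<in>space (prob P). \<forall>x\<in>wall P. slip P \<epsilon> \<omega> x \<le> \<gamma>1 \<epsilon> * C\<alpha>) \<longrightarrow>
    (\<forall>\<epsilon>>0. \<forall>\<omega>\<in>space (prob P). \<forall>x\<in>wall P. \<forall>y\<in>wall P.
       \<bar>slip P \<epsilon> \<omega> x - slip P \<epsilon> \<omega> y\<bar> \<le> \<gamma>1 \<epsilon> / \<gamma>3 \<epsilon> * C\<alpha> * norm (x - y)) \<longrightarrow>
    (\<forall>\<epsilon>>0. \<forall>x\<in>wall P.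
       (AE \<omega> in prob P. aligned (\<eta>1 \<epsilon>) (micro_curve P \<epsilon> \<omega> x) (r1 P \<epsilon> \<omega> x) (micro_data P \<epsilon> \<omega> x)) \<and>
       (AE \<omega> in prob P. aligned (\<eta>2 \<epsilon>) (micro_curve P \<epsilon> \<omega> x) (s2 P \<epsilon> \<omega> x) (micro_data P \<epsilon> \<omega> x)) \<and>
       (AE \<omega> in prob P.
          \<bar>bdry_inner (micro_curve P \<epsilon> \<omega> x) (r1 P \<epsilon> \<omega> x) (micro_data P \<epsilon> \<omega> x)
           / bdry_inner (micro_curve P \<epsilon> \<omega> x) (r2 P \<epsilon> \<omega> x) (micro_data P \<epsilon> \<omega> x)\<bar> \<le> \<gamma>1 \<epsilon> * C\<alpha>) \<and>
       integrable (prob P)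
         (\<lambda>\<omega>. rel_error_sq (micro_curve P \<epsilon> \<omega> x) (s1 P \<epsilon> \<omega> x) (r1 P \<epsilon> \<omega> x) (r1 P \<epsilon> \<omega> x)) \<and>
       prob_space.expectation (prob P)
         (\<lambda>\<omega>. rel_error_sq (micro_curve P \<epsilon> \<omega> x) (s1 P \<epsilon> \<omega> x) (r1 P \<epsilon> \<omega> x) (r1 P \<epsilon> \<omega> x))
         \<le> (\<delta> \<epsilon>)\<^sup>2 \<and>
       integrable (prob P)
         (\<lambda>\<omega>. rel_error_sq (micro_curve P \<epsilon> \<omega> x) (s2 P \<epsilon> \<omega> x) (r2 P \<epsilon> \<omega> x) (s2 P \<epsilon> \<omega> x)) \<and>
       prob_space.expectation (prob P)
         (\<lambda>\<omega>. rel_error_sq (micro_curve P \<epsilon> \<omega> x) (s2 P \<epsilon> \<omega> x) (r2 P \<epsilon> \<omega> x) (s2 P \<epsilon> \<omega> x))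
         \<le> (\<delta> \<epsilon>)\<^sup>2) \<longrightarrow>
    (\<forall>\<epsilon>>0. accurate (\<gamma>1 \<epsilon>) (\<gamma>2 \<epsilon>) (\<gamma>3 \<epsilon>) (wall_length P) (\<delta> \<epsilon>) \<longrightarrow>
      (\<forall>(x :: nat \<Rightarrow> nat \<Rightarrow> plane) (I :: nat \<Rightarrow> (nat \<Rightarrow> real) \<Rightarrow> plane \<Rightarrow> real).
        (\<forall>N\<ge>1. x N ` {1..N} \<subseteq> wall P \<and>
           resolution (wall P) N (x N) \<le> wall_length P / real N \<and>
           interpolant (wall P) N (x N) CI (I N) \<and>
           (\<forall>\<omega>\<in>space (prob P). tightly_interpolates (wall P) N (x N) CI (I N)
              (\<gamma>1 \<epsilon> / \<gamma>3 \<epsilon> * C\<alpha>) (slip P \<epsilon> \<omega>))) \<longrightarrow>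
        (\<exists>N\<ge>1.
           integrable (prob P)
             (\<lambda>\<omega>. SUP z\<in>wall P. \<bar>I N (\<lambda>n. approx_slip P \<epsilon> \<omega> (x N n)) z - slip P \<epsilon> \<omega> z\<bar>) \<and>
           prob_space.expectation (prob P)
             (\<lambda>\<omega>. SUP z\<in>wall P. \<bar>I N (\<lambda>n. approx_slip P \<epsilon> \<omega> (x N n)) z - slip P \<epsilon> \<omega> z\<bar>)
             \<le> 2 * \<gamma>1 \<epsilon> * C * sqrt (\<delta> \<epsilon> * wall_length P * \<gamma>2 \<epsilon> / (\<gamma>1 \<epsilon> * \<gamma>3 \<epsilon>)))))"
proof (intro exI[of _ "7 / 2 * CI * C\<alpha>"] conjI allI impI, goal_cases)
  case 1
  show ?case using assms by simp
next
  case (2 P \<gamma>1 \<gamma>2 \<gamma>3 \<eta>1 \<eta>2 \<delta> \<epsilon> x I)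
  have \<epsilon>: "0 < \<epsilon>" by fact
  have pos: "0 < \<gamma>1 \<epsilon>" "0 < \<gamma>2 \<epsilon>" "0 < \<gamma>3 \<epsilon>" "0 < \<delta> \<epsilon>"
    using 2(2) \<epsilon> by auto
  have \<eta>: "\<eta>1 \<epsilon> = \<gamma>1 \<epsilon> / \<gamma>2 \<epsilon>" "\<eta>2 \<epsilon> = 1 / \<gamma>2 \<epsilon>"
    using 2(7) \<epsilon> by auto
  have l: "0 < wall_length P"
    using 2(1) by (simp add: rough_problem_def smooth_wall_def)
  note hyp = 2(10)[rule_format, OF \<epsilon>, unfolded \<eta>]
  define N where "N = nat \<lceil>sqrt (\<gamma>1 \<epsilon> * wall_length P / (\<gamma>2 \<epsilon> * \<gamma>3 \<epsilon> * \<delta> \<epsilon>))\<rceil>"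
  note balance = balanced_error[OF pos(1-3) l pos(4) 2(12), folded N_def]
  note interp = 2(13)[rule_format, OF balance(1)]
  note bound = expected_interpolated_slip_error[OF 2(1) \<epsilon> pos assms balance(1),
      of "x N" "wall_length P / real N" "I N"]
  show ?case
  proof (intro exI[of _ N] conjI)
    show "1 \<le> N" by (rule balance)
    show "integrable (prob P)
        (\<lambda>\<omega>. SUP z\<in>wall P. \<bar>I N (\<lambda>n. approx_slip P \<epsilon> \<omega> (x N n)) z - slip P \<epsilon> \<omega> z\<bar>)"
      by (rule bound(1)) (use hyp interp in auto)
    have "prob_space.expectation (prob P)
        (\<lambda>\<omega>. SUP z\<in>wall P. \<bar>I N (\<lambda>n. approx_slip P \<epsilon> \<omega> (x N n)) z - slip P \<epsilon> \<omega> z\<bar>)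
      \<le> CI * C\<alpha> * (\<gamma>1 \<epsilon> / \<gamma>3 \<epsilon> * (wall_length P / N)
        + \<gamma>2 \<epsilon> * (N * \<delta> \<epsilon> * (1 + \<gamma>2 \<epsilon> * \<delta> \<epsilon>) + \<gamma>1 \<epsilon> * (sqrt N * \<delta> \<epsilon>)))"
      by (rule bound(2)) (use hyp interp in auto)
    also have "\<dots> \<le> CI * C\<alpha>
        * (7 * (\<gamma>1 \<epsilon> * sqrt (\<delta> \<epsilon> * wall_length P * \<gamma>2 \<epsilon> / (\<gamma>1 \<epsilon> * \<gamma>3 \<epsilon>))))"
      using assms by (intro mult_left_mono balance(2)) auto
    finally show "prob_space.expectation (prob P)
        (\<lambda>\<omega>. SUP z\<in>wall P. \<bar>I N (\<lambda>n. approx_slip P \<epsilon> \<omega> (x N n)) z - slip P \<epsilon> \<omega> z\<bar>)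
      \<le> 2 * \<gamma>1 \<epsilon> * (7 / 2 * CI * C\<alpha>)
        * sqrt (\<delta> \<epsilon> * wall_length P * \<gamma>2 \<epsilon> / (\<gamma>1 \<epsilon> * \<gamma>3 \<epsilon>))"
      by (simp add: mult_ac)
  qed
qed

end
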